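(* Suppose that the undirected graph $\mathcal G$ is connected. A matrix $X^*\in\mathbb R^{r\times p}$ is a least squares solution to the matrix equation $AXB=F$ if and only if there exists $Y^*=AX^*\in\mathbb R^{m\times p}$ such that $(X_{\rm E}^*,Y_{\rm E}^* )=(1_n\otimes X^*,1_n\otimes Y^* )$ is a solution to the optimization problem $$\min_{X_{\rm E},Y_{\rm E}}\ \sum_{i=1}^n\|Y_iB_{li}-F_{li}\|_{\rm F}^2\quad\text{s.t.}\quad X_i=X_j,\ Y_i=Y_j,\ A_{vi}X_i=Y_i^{vi},\ \ i,j\in\{1,\ldots,n\}.$$
   Context: $A\in\mathbb R^{m\times r}$, $B\in\mathbb R^{p\times q}$, $F\in\mathbb R^{m\times q}$ are partitioned (Row-Column-Column structure) as $A=[A_{v1}^{\rm T},\ldots,A_{vn}^{\rm T}]^{\rm T}$, $B=[B_{l1},\ldots,B_{ln}]$, $F=[F_{l1},\ldots,F_{ln}]$ with $A_{vi}\in\mathbb R^{m_i\times r}$, $B_{li}\in\mathbb R^{p\times q_i}$, $F_{li}\in\mathbb R^{m\times q_i}$, $\sum_{i=1}^n m_i=m$, $\sum_{i=1}^n q_i=q$. The variables are $X_{\rm E}=[X_1^{\rm T},\ldots,X_n^{\rm T}]^{\rm T}\in\mathbb R^{nr\times p}$ with $X_i\in\mathbb R^{r\times p}$ and $Y_{\rm E}=[Y_1^{\rm T},\ldots,Y_n^{\rm T}]^{\rm T}\in\mathbb R^{nm\times p}$ with $Y_i\in\mathbb R^{m\times p}$; each $Y_i$ is partitioned into row-blocks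 $Y_i=[(Y_i^{v1})^{\rm T},\ldots,(Y_i^{vn})^{\rm T}]^{\rm T}$ with $Y_i^{vj}\in\mathbb R^{m_j\times p}$. $1_n$ is the all-ones column vector of length $n$, $\otimes$ the Kronecker product, $\|\cdot\|_{\rm F}$ the Frobenius norm. A least squares solution to $AXB=F$ is a minimizer of $\|AXB-F\|_{\rm F}^2$ over $X\in\mathbb R^{r\times p}$. $\mathcal G$ is the graph of the $n$-agent network, with node set $\{1,\ldots,n\}$. *)

theory Defs
  imports
    "Jordan_Normal_Form.Matrix"
    "Graph_Theory.Digraph_Component"
begin

definition frobenius_norm :: "real mat \<Rightarrow> real" where
  "frobenius_norm M = sqrt (\<Sum>i<dim_row M. \<Sum>j<dim_col M. (M $$ (i, j))\<^sup>2)"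

definition kronecker :: "real mat \<Rightarrow> real mat \<Rightarrow> real mat" where
  "kronecker M N = mat (dim_row M * dim_row N) (dim_col M * dim_col N)
     (\<lambda>(i, j). M $$ (i div dim_row N, j div dim_col N) * N $$ (i mod dim_row N, j mod dim_col N))"

definition ones :: "nat \<Rightarrow> real mat" where
  "ones n = mat n 1 (\<lambda>_. 1)"

text \<open>
  A matrix partitioned into consecutive row blocks of heights \<open>d 1, d 2, \<dots>\<close> has
  \<open>row_block d M i\<close> as its \<open>i\<close>-th block; likewise for column blocks. Blocks are numbered
  from 1, matching the agents, whereas the entries of a matrix are numbered from 0.
\<close>

definition row_block :: "(nat \<Rightarrow> nat) \<Rightarrow> real mat \<Rightarrow> nat \<Rightarrow> real mat" where
  "row_block d M i = mat (d i) (dim_col M) (\<lambda>(k, l). M $$ ((\<Sum>j\<in>{1..<i}. d j) + k, l))"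

definition col_block :: "(nat \<Rightarrow> nat) \<Rightarrow> real mat \<Rightarrow> nat \<Rightarrow> real mat" where
  "col_block d M i = mat (dim_row M) (d i) (\<lambda>(k, l). M $$ (k, (\<Sum>j\<in>{1..<i}. d j) + l))"

definition least_squares_solution ::
  "nat \<Rightarrow> nat \<Rightarrow> real mat \<Rightarrow> real mat \<Rightarrow> real mat \<Rightarrow> real mat \<Rightarrow> bool" where
  "least_squares_solution r p A B F X \<longleftrightarrow>
     is_arg_min (\<lambda>X. (frobenius_norm (A * X * B - F))\<^sup>2) (\<lambda>X. X \<in> carrier_mat r p) X"

definition distributed_objective ::
  "nat \<Rightarrow> nat \<Rightarrow> (nat \<Rightarrow> nat) \<Rightarrow> real mat \<Rightarrow> real mat \<Rightarrow> real mat \<times> real mat \<Rightarrow> real" where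
  "distributed_objective n m qs B F = (\<lambda>(XE, YE).
     \<Sum>i = 1..n. (frobenius_norm (row_block (\<lambda>_. m) YE i * col_block qs B i - col_block qs F i))\<^sup>2)"

definition distributed_feasible ::
  "nat \<Rightarrow> nat \<Rightarrow> nat \<Rightarrow> nat \<Rightarrow> (nat \<Rightarrow> nat) \<Rightarrow> real mat \<Rightarrow> real mat \<times> real mat \<Rightarrow> bool" where
  "distributed_feasible n m r p ms A = (\<lambda>(XE, YE).
     XE \<in> carrier_mat (n * r) p \<and> YE \<in> carrier_mat (n * m) p \<and>
     (\<forall>i\<in>{1..n}. \<forall>j\<in>{1..n}. row_block (\<lambda>_. r) XE i = row_block (\<lambda>_. r) XE j) \<and>
     (\<forall>i\<in>{1..n}. \<forall>j\<in>{1..n}. row_block (\<lambda>_. m) YE i = row_block (\<lambda>_. m) YE j) \<and>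
     (\<forall>i\<in>{1..n}. row_block ms A i * row_block (\<lambda>_. r) XE i
                  = row_block ms (row_block (\<lambda>_. m) YE i) i))"

definition distributed_solution ::
  "nat \<Rightarrow> nat \<Rightarrow> nat \<Rightarrow> nat \<Rightarrow> (nat \<Rightarrow> nat) \<Rightarrow> (nat \<Rightarrow> nat) \<Rightarrow>
   real mat \<Rightarrow> real mat \<Rightarrow> real mat \<Rightarrow> real mat \<times> real mat \<Rightarrow> bool" where
  "distributed_solution n m r p ms qs A B F Z \<longleftrightarrow>
     is_arg_min (distributed_objective n m qs B F) (distributed_feasible n m r p ms A) Z"

end

theory Submission
  imports Defs
begin

text \<open>
  On the consensus constraints all \<open>X\<^sub>i\<close> equal one matrix \<open>X\<close> and all \<open>Y\<^sub>i\<close> one matrix \<open>Y\<close>. The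
  constraints \<open>A\<^sub>v\<^sub>i X = Y\<^sup>v\<^sup>i\<close> are then the row blocks of \<open>A X = Y\<close>, and the summands of
  the objective are the squared norms of the column blocks of \<open>Y B - F\<close>. So the objective at a
  feasible point is the least squares residual at \<open>X\<close>, and every \<open>X\<close> arises from a feasible point.
\<close>

text \<open>Induction on \<open>n\<close>: the offset of the last block is the total length of the
  earlier ones, so appending it extends the range of \<open>l\<close> at its end.\<close>

lemma sum_consecutive_blocks:
  fixes d :: "nat \<Rightarrow> nat" and g :: "nat \<Rightarrow> 'a::comm_monoid_add"
  shows "(\<Sum>i = 1..n. \<Sum>l<d i. g ((\<Sum>j\<in>{1..<i}. d j) + l)) = (\<Sum>l<(\<Sum>i = 1..n. d i). g l)"
proof (induction n)
  case (Suc n)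
  have "(\<Sum>l<s + t. g l) = (\<Sum>l<s. g l) + (\<Sum>l<t. g (s + l))" for s t
    by (induction t) (simp_all add: add.assoc)
  with Suc show ?case
    by (simp add: atLeastLessThanSuc_atLeastAtMost)
qed simp

lemma consecutive_blocks_cover:
  fixes d :: "nat \<Rightarrow> nat"
  assumes "k < (\<Sum>i = 1..n. d i)"
  obtains i l where "i \<in> {1..n}" "l < d i" "k = (\<Sum>j\<in>{1..<i}. d j) + l"
  using assms
proof (induction n arbitrary: thesis)
  case (Suc n)
  show ?case
  proof (cases "k < (\<Sum>i = 1..n. d i)")
    case True
    then show ?thesis
      using Suc.IH Suc.prems(1) by (metis atLeastAtMost_iff le_SucI)
  next
    case False
    then show ?thesis
      using Suc.prems
      \<comment> \<open>An index past the first \<open>n\<close> blocks lies in the last one, at its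
        distance from the start of that block.\<close>
      by (intro Suc.prems(1)[of "Suc n" "k - (\<Sum>i = 1..n. d i)"])
        (auto simp: atLeastLessThanSuc_atLeastAtMost)
  qed
qed simp

text \<open>Keeps shifted block indices within the matrix dimensions, where the entries of products
  and differences can be unfolded.\<close>

lemma consecutive_block_bound:
  fixes d :: "nat \<Rightarrow> nat"
  assumes "i \<in> {1..n}" "l < d i"
  shows "(\<Sum>j\<in>{1..<i}. d j) + l < (\<Sum>i = 1..n. d i)"
proof -
  have "(\<Sum>j\<in>{1..<i}. d j) + l < (\<Sum>j\<in>insert i {1..<i}. d j)"
    using assms by simp
  also have "\<dots> \<le> (\<Sum>i = 1..n. d i)"
    using assms by (intro sum_mono2) auto
  finally show ?thesis .
qed

text \<open>Columns are summed outermost, so that a partition into column blocks only regroups the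
  outer sum.\<close>

lemma frobenius_norm_sq:
  "(frobenius_norm M)\<^sup>2 = (\<Sum>j<dim_col M. \<Sum>i<dim_row M. (M $$ (i, j))\<^sup>2)"
  unfolding frobenius_norm_def by (subst sum.swap) (simp add: sum_nonneg)

lemma sum_frobenius_norm_sq_col_block:
  assumes "M \<in> carrier_mat k (\<Sum>i = 1..n. d i)"
  shows "(\<Sum>i = 1..n. (frobenius_norm (col_block d M i))\<^sup>2) = (frobenius_norm M)\<^sup>2"
  using assms sum_consecutive_blocks[where d = d and n = n and g = "\<lambda>l. \<Sum>i<k. (M $$ (i, l))\<^sup>2"]
  by (simp add: frobenius_norm_sq col_block_def)

text \<open>Each column of \<open>Y * B\<close> depends on \<open>B\<close> only through the same
  column, so taking column blocks commutes with left multiplication by \<open>Y\<close>.\<close>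

lemma col_block_residual:
  assumes "Y \<in> carrier_mat m p" "B \<in> carrier_mat p (\<Sum>i = 1..n. d i)"
    and "F \<in> carrier_mat m (\<Sum>i = 1..n. d i)" "i \<in> {1..n}"
  shows "Y * col_block d B i - col_block d F i = col_block d (Y * B - F) i"
  using assms consecutive_block_bound[of i n _ d]
  by (intro eq_matI) (auto simp: col_block_def scalar_prod_def)

lemma row_block_mult:
  assumes "A \<in> carrier_mat (\<Sum>i = 1..n. d i) r" "X \<in> carrier_mat r p" "i \<in> {1..n}"
  shows "row_block d A i * X = row_block d (A * X) i"
  using assms consecutive_block_bound[of i n _ d]
  by (intro eq_matI) (auto simp: row_block_def scalar_prod_def)

text \<open>Every row index falls into some block, where the entry can be read off; this turns the
  local constraints into one global equation.\<close>

lemma row_block_eqI: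
  assumes "M \<in> carrier_mat (\<Sum>i = 1..n. d i) p" "N \<in> carrier_mat (\<Sum>i = 1..n. d i) p"
    and eq: "\<And>i. i \<in> {1..n} \<Longrightarrow> row_block d M i = row_block d N i"
  shows "M = N"
proof (rule eq_matI)
  fix k l assume "k < dim_row N" "l < dim_col N"
  with assms(2) have "k < (\<Sum>i = 1..n. d i)" "l < p"
    by auto
  from this(1) obtain i k' where
    *: "i \<in> {1..n}" "k' < d i" "k = (\<Sum>j\<in>{1..<i}. d j) + k'"
    by (rule consecutive_blocks_cover)
  then show "M $$ (k, l) = N $$ (k, l)"
    using assms(1,2) \<open>l < p\<close> arg_cong[OF eq[OF *(1)], of "\<lambda>R. R $$ (k', l)"]
    by (simp add: row_block_def)
qed (use assms in auto)

lemma kronecker_ones_carrier: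
  "X \<in> carrier_mat h p \<Longrightarrow> kronecker (ones n) X \<in> carrier_mat (n * h) p"
  by (auto simp: kronecker_def ones_def)

lemma row_block_kronecker_ones:
  assumes "X \<in> carrier_mat h p" "i \<in> {1..n}"
  shows "row_block (\<lambda>_. h) (kronecker (ones n) X) i = X"
proof (rule eq_matI)
  fix k l assume kl: "k < dim_row X" "l < dim_col X"
  \<comment> \<open>Blocks count from 1 and rows from 0, so block \<open>i\<close> starts at row
    \<open>(i - 1) * h\<close>.\<close>
  have "(i - 1) * h + k < n * h"
    using consecutive_block_bound[of i n k "\<lambda>_. h"] assms kl by simp
  \<comment> \<open>The quotient has to be a valid row of \<open>ones n\<close> for its entry there
    to be 1.\<close>
  moreover have "((i - 1) * h + k) div h < n"
    using calculation by (simp add: less_mult_imp_div_less)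
  ultimately show "row_block (\<lambda>_. h) (kronecker (ones n) X) i $$ (k, l) = X $$ (k, l)"
    using assms kl by (simp add: row_block_def kronecker_def ones_def)
qed (use assms in \<open>auto simp: row_block_def kronecker_def ones_def\<close>)

lemma row_block_const_carrier:
  "M \<in> carrier_mat k p \<Longrightarrow> row_block (\<lambda>_. h) M i \<in> carrier_mat h p"
  by (simp add: row_block_def)

lemma distributed_feasible_kronecker:
  assumes "A \<in> carrier_mat m r" "m = (\<Sum>i = 1..n. ms i)" "X \<in> carrier_mat r p"
  shows "distributed_feasible n m r p ms A (kronecker (ones n) X, kronecker (ones n) (A * X))"
proof -
  have AX: "A * X \<in> carrier_mat m p"
    using assms(1,3) by simp
  have "row_block ms A i * X = row_block ms (A * X) i" if "i \<in> {1..n}" for i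
    using row_block_mult[OF _ assms(3) that] assms(1,2) by simp
  then show ?thesis
    using assms(3) AX
    by (simp add: distributed_feasible_def kronecker_ones_carrier row_block_kronecker_ones)
qed

lemma distributed_objective_consensus:
  assumes "Y \<in> carrier_mat m p" "B \<in> carrier_mat p (\<Sum>i = 1..n. qs i)"
    and "F \<in> carrier_mat m (\<Sum>i = 1..n. qs i)"
    and "\<And>i. i \<in> {1..n} \<Longrightarrow> row_block (\<lambda>_. m) YE i = Y"
  shows "distributed_objective n m qs B F (XE, YE) = (frobenius_norm (Y * B - F))\<^sup>2"
proof -
  have "Y * B - F \<in> carrier_mat m (\<Sum>i = 1..n. qs i)"
    using assms by auto
  from sum_frobenius_norm_sq_col_block[OF this] show ?thesis
    using assms by (simp add: distributed_objective_def col_block_residual[where n = n])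
qed

text \<open>The blocks of agent 1 represent all agents by consensus; stacking the local constraints
  then gives \<open>A * ?X = ?Y\<close>.\<close>

lemma distributed_feasible_consensus:
  assumes "A \<in> carrier_mat m r" "m = (\<Sum>i = 1..n. ms i)" "1 \<le> n"
    and feas: "distributed_feasible n m r p ms A (XE, YE)"
  obtains X where "X \<in> carrier_mat r p"
    and "\<And>i. i \<in> {1..n} \<Longrightarrow> row_block (\<lambda>_. m) YE i = A * X"
proof
  let ?X = "row_block (\<lambda>_. r) XE 1" and ?Y = "row_block (\<lambda>_. m) YE 1"
  from feas have carr: "XE \<in> carrier_mat (n * r) p" "YE \<in> carrier_mat (n * m) p"
    by (simp_all add: distributed_feasible_def)
  then show X: "?X \<in> carrier_mat r p"
    by (simp add: row_block_const_carrier)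
  have Xi: "row_block (\<lambda>_. r) XE i = ?X" and Yi: "row_block (\<lambda>_. m) YE i = ?Y"
    and blk: "row_block ms A i * row_block (\<lambda>_. r) XE i = row_block ms (row_block (\<lambda>_. m) YE i) i"
    if "i \<in> {1..n}" for i
  proof -
    have "1 \<in> {1..n}"
      using \<open>1 \<le> n\<close> by simp
    then show "row_block (\<lambda>_. r) XE i = ?X" "row_block (\<lambda>_. m) YE i = ?Y"
      "row_block ms A i * row_block (\<lambda>_. r) XE i = row_block ms (row_block (\<lambda>_. m) YE i) i"
      using feas that unfolding distributed_feasible_def by blast+
  qed
  have "A * ?X = ?Y"
  proof (rule row_block_eqI[where d = ms and n = n and p = p])
    show "A * ?X \<in> carrier_mat (\<Sum>i = 1..n. ms i) p"
      using assms(1,2) X by simp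
    show "?Y \<in> carrier_mat (\<Sum>i = 1..n. ms i) p"
      using row_block_const_carrier[OF carr(2)] assms(2) by simp
    fix i assume i: "i \<in> {1..n}"
    have "row_block ms (A * ?X) i = row_block ms A i * ?X"
      using row_block_mult[OF _ X i] assms(1,2) by simp
    also have "\<dots> = row_block ms ?Y i"
      using blk[OF i] Xi[OF i] Yi[OF i] by simp
    finally show "row_block ms (A * ?X) i = row_block ms ?Y i" .
  qed
  then show "row_block (\<lambda>_. m) YE i = A * ?X" if "i \<in> {1..n}" for i
    using Yi[OF that] by simp
qed

theorem mainTheorem2:
  fixes G :: "(nat, 'e) pre_digraph"
    and n m r p q :: nat
    and ms qs :: "nat \<Rightarrow> nat"
    and A B F Xs :: "real mat"
  assumes "graph G" and "verts G = {1..n}" and "Digraph_Component.connected G"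
    and "(\<Sum>i = 1..n. ms i) = m" and "(\<Sum>i = 1..n. qs i) = q"
    and "A \<in> carrier_mat m r" and "B \<in> carrier_mat p q" and "F \<in> carrier_mat m q"
    and "Xs \<in> carrier_mat r p"
  shows "least_squares_solution r p A B F Xs \<longleftrightarrow>
    (\<exists>Ys \<in> carrier_mat m p. Ys = A * Xs \<and>
       distributed_solution n m r p ms qs A B F (kronecker (ones n) Xs, kronecker (ones n) Ys))"
proof -
  \<comment> \<open>A connected graph has a nonempty vertex set by definition, so agent 1
    exists.\<close>
  have n: "1 \<le> n"
    using assms(2,3) by (auto simp: Digraph_Component.connected_def strongly_connected_def)
  let ?f = "\<lambda>X. (frobenius_norm (A * X * B - F))\<^sup>2"
  let ?lift = "\<lambda>X. (kronecker (ones n) X, kronecker (ones n) (A * X))"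
  let ?feas = "distributed_feasible n m r p ms A" and ?obj = "distributed_objective n m qs B F"
  have obj: "?obj (XE, YE) = ?f X"
    if "X \<in> carrier_mat r p" "\<And>i. i \<in> {1..n} \<Longrightarrow> row_block (\<lambda>_. m) YE i = A * X" for XE YE X
    using that assms by (intro distributed_objective_consensus[where p = p]) auto
  have lift: "?feas (?lift X)" "?obj (?lift X) = ?f X" if "X \<in> carrier_mat r p" for X
  proof -
    show "?feas (?lift X)"
      using that assms by (intro distributed_feasible_kronecker) auto
    have "A * X \<in> carrier_mat m p"
      using that assms by auto
    then show "?obj (?lift X) = ?f X"
      using obj[OF that] row_block_kronecker_ones by blast
  qed
  have proj: "\<exists>X \<in> carrier_mat r p. ?obj Z = ?f X" if "?feas Z" for Z
  proof (cases Z)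
    case (Pair XE YE)
    with that assms n obtain X where "X \<in> carrier_mat r p"
      "\<And>i. i \<in> {1..n} \<Longrightarrow> row_block (\<lambda>_. m) YE i = A * X"
      using distributed_feasible_consensus[of A m r ms n p XE YE] by blast
    then show ?thesis
      using obj Pair by blast
  qed
  have "least_squares_solution r p A B F Xs \<longleftrightarrow>
      distributed_solution n m r p ms qs A B F (?lift Xs)"
  proof -
    \<comment> \<open>Both problems attain values below the same thresholds: \<open>lift\<close>
      gives one direction, \<open>proj\<close> the other. With \<open>c\<close> the common value at
      \<open>Xs\<close> and its lift, minimality in one problem is minimality in the other.\<close>
    have "(\<exists>X \<in> carrier_mat r p. ?f X < c) \<longleftrightarrow> (\<exists>Z. ?feas Z \<and> ?obj Z < c)" for c
      using lift proj by metis
    then show ?thesis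
      using lift[OF \<open>Xs \<in> carrier_mat r p\<close>] \<open>Xs \<in> carrier_mat r p\<close>
      unfolding least_squares_solution_def distributed_solution_def is_arg_min_def by auto
  qed
  moreover have "A * Xs \<in> carrier_mat m p"
    using assms by auto
  ultimately show ?thesis
    by blast
qed

end
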